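(* Let $a,b,c\in\mathbb{R}$ with $a\neq 0$, let $g:\mathbb{R}\to\mathbb{R}$, $g(x)=ax^2+bx+c$, let $\delta:=b^2-4ac-2b-7$, and assume that $\delta>0$. Let $(x,y,z)$ be a representative of the 3-cycle $\mathcal{C}_{\langle\delta\rangle}$ of the map $x_{t+1}=g(x_t)$, and let $r=\frac{z-y}{y-x}$ be the ratio between successive distances. The following statements are equivalent: (i) $\mathcal{C}_{\langle\delta\rangle}$ is asymptotically stable; (ii) $r\in(-1.801..,-1.713..]\cup(-0.445..,-0.416..]\cup(1.246..,1.401..]$.
   Context: The two dots after a decimal number, as in $1.246..$, indicate that only the first digits of the decimal expansion of the number are displayed. A 3-cycle of the map $x_{t+1}=g(x_t)$ is the class, modulo cyclic permutation, of an ordered triple $(x,y,z)$ of pairwise distinct real numbers with $g(x)=y$, $g(y)=z$, $g(z)=x$; any such triple is called a representative of the 3-cycle, and $x,y,z$ are its points. For $\beta\in\mathbb{R}$ let $Q_\beta(X)=X^3+(1-\beta)X^2-(2+\beta)X-1$. All roots of $Q_\beta$ are real, distinct and nonzero; they are denoted $q^{\langle\beta\rangle}_1<q^{\langle\beta\rangle}_2<q^{\langle\beta\rangle}_3$. For $\delta>0$ the map has exactly two 3-cycles; $\mathcal{C}_{\langle\delta\rangle}$ is the one whose points are $\frac{-b+\sqrt{\delta}+1}{2a}+\frac{1}{a q^{\langle\sqrt{\delta}\rangle}_i}$, $i\in\{1,2,3\}$. Write $g^{(n)}$ for the $n$-th iterate of $g$. A 3-cycle is stable if one (equivalently, any) of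 its points $x$ is a Lyapunov stable fixed point of $g^{(3)}$: for every $\varepsilon>0$ there is $\eta>0$ such that $|x_0-x|<\eta$ implies $|g^{(3t)}(x_0)-x|<\varepsilon$ for all $t\in\mathbb{N}$. It is asymptotically stable if it is stable and there is $\gamma>0$ such that $|x_0-x|<\gamma$ implies $\lim_{t\to\infty}g^{(3t)}(x_0)=x$. *)

theory Defs
  imports Complex_Main "HOL-Computational_Algebra.Polynomial"
begin

text \<open>A 3-cycle is a class of triples modulo cyclic permutation, encoded as the set of its
  three representatives.\<close>

definition three_cycle :: "(real \<Rightarrow> real) \<Rightarrow> (real \<times> real \<times> real) set \<Rightarrow> bool" where
  "three_cycle g C \<longleftrightarrow>
     (\<exists>x y z. x \<noteq> y \<and> y \<noteq> z \<and> x \<noteq> z \<and> g x = y \<and> g y = z \<and> g z = x \<and>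
        C = {(x, y, z), (y, z, x), (z, x, y)})"

definition cycle_points :: "(real \<times> real \<times> real) set \<Rightarrow> real set" where
  "cycle_points C = {x. \<exists>y z. (x, y, z) \<in> C}"

definition lyapunov_stable3 :: "(real \<Rightarrow> real) \<Rightarrow> real \<Rightarrow> bool" where
  "lyapunov_stable3 g x \<longleftrightarrow>
     (\<forall>\<epsilon>>0. \<exists>\<eta>>0. \<forall>x0. \<bar>x0 - x\<bar> < \<eta> \<longrightarrow> (\<forall>t. \<bar>(g ^^ (3 * t)) x0 - x\<bar> < \<epsilon>))"

definition attracting3 :: "(real \<Rightarrow> real) \<Rightarrow> real \<Rightarrow> bool" where
  "attracting3 g x \<longleftrightarrow>
     (\<exists>\<gamma>>0. \<forall>x0. \<bar>x0 - x\<bar> < \<gamma> \<longrightarrow> (\<lambda>t. (g ^^ (3 * t)) x0) \<longlonglongrightarrow> x)"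

definition asymptotically_stable_cycle ::
    "(real \<Rightarrow> real) \<Rightarrow> (real \<times> real \<times> real) set \<Rightarrow> bool" where
  "asymptotically_stable_cycle g C \<longleftrightarrow>
     (\<exists>x\<in>cycle_points C. lyapunov_stable3 g x \<and> attracting3 g x)"

definition Q :: "real \<Rightarrow> real poly" where
  "Q \<beta> = [:- 1, - (2 + \<beta>), 1 - \<beta>, 1:]"

text \<open>The roots in increasing order, indexed by 1, 2, 3.\<close>

definition q :: "real \<Rightarrow> nat \<Rightarrow> real" where
  "q \<beta> i = sorted_list_of_set {t. poly (Q \<beta>) t = 0} ! (i - 1)"

definition cycle_delta ::
    "(real \<Rightarrow> real) \<Rightarrow> real \<Rightarrow> real \<Rightarrow> real \<Rightarrow> (real \<times> real \<times> real) set" where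
  "cycle_delta g a b \<delta> =
     (THE C. three_cycle g C \<and>
        cycle_points C =
          (\<lambda>i. (- b + sqrt \<delta> + 1) / (2 * a) + 1 / (a * q (sqrt \<delta>) i)) ` {1, 2, 3})"

text \<open>The multiplier of \<^term>\<open>cycle_delta g a b (\<beta>\<^sup>2)\<close> is
  \<open>1 - 7 * \<beta> - \<beta>^2 - \<beta>^3\<close>. For positive \<open>\<beta>\<close> it is smaller than 1, and it equals -1 exactly at
  \<open>\<beta>_crit\<close> (about 0.272). The ratio of a representative is a root of \<^term>\<open>Q \<beta>\<close>, so
  the roots of \<^term>\<open>Q 0\<close> and of \<open>Q \<beta>_crit\<close> are the ends of the ranges of ratios that
  belong to a stable cycle.\<close>

definition \<beta>_crit :: real where
  "\<beta>_crit = (THE \<beta>. \<beta> ^ 3 + \<beta>\<^sup>2 + 7 * \<beta> - 2 = 0)"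

text \<open>Truncation towards zero of the decimal expansion of \<open>x\<close> after \<open>n\<close> decimal places: a number
  displayed with \<open>n\<close> decimals followed by two dots is a real number with this truncation.\<close>

definition decimal_trunc :: "nat \<Rightarrow> real \<Rightarrow> real" where
  "decimal_trunc n x = sgn x * of_int \<lfloor>\<bar>x\<bar> * 10 ^ n\<rfloor> / 10 ^ n"

end

theory Submission
  imports Defs
begin

text \<open>
  Put \<open>\<beta> = sqrt \<delta>\<close>. The Moebius map \<open>t \<mapsto> - 1 - 1 / t\<close> of order three permutes the roots of
  \<^term>\<open>Q \<beta>\<close>, and sending a root \<open>t\<close> to the cycle point \<open>(- b + \<beta> + 1) / (2 * a) + 1 / (a * t)\<close>
  conjugates it to \<open>g\<close>; along this orbit the ratio \<open>r\<close> is the root \<open>t\<close> itself. The multiplier of the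
  cycle is \<open>1 - 7 * \<beta> - \<beta>\<^sup>2 - \<beta> ^ 3 < 1\<close>, so only the crossing of -1 matters. In the boundary case
  of multiplier -1 the cycle still attracts, because a quadratic map has negative Schwarzian
  derivative.
\<close>

section \<open>Fixed points of one-dimensional maps\<close>

text \<open>The distances to \<open>x\<close> decrease to some \<open>L\<close>. If
  \<open>L > 0\<close>, the orbit stays in the compact set \<open>K\<close> of points at distance
  between \<open>L\<close> and \<open>e 0\<close>, where the decrease per step has a positive
  minimum \<open>\<mu>\<close>; passing to the limit then gives
  \<open>L \<le> L - \<mu>\<close>.\<close>

lemma iterates_tendsto_fixed_point:
  fixes h :: "real \<Rightarrow> real"
  assumes cont: "continuous_on UNIV h"
    and dec: "\<And>y. 0 < \<bar>y - x\<bar> \<Longrightarrow> \<bar>y - x\<bar> < \<rho> \<Longrightarrow> \<bar>h y - x\<bar> < \<bar>y - x\<bar>"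
    and fixp: "h x = x" and y: "\<bar>y - x\<bar> < \<rho>"
  shows "(\<lambda>n. (h ^^ n) y) \<longlonglongrightarrow> x"
proof -
  define e where "e n = \<bar>(h ^^ n) y - x\<bar>" for n
  have le: "\<bar>h w - x\<bar> \<le> \<bar>w - x\<bar>" if "\<bar>w - x\<bar> < \<rho>" for w
    using dec[of w] that fixp by (cases "w = x") auto
  have e_lt: "e n < \<rho>" for n
  proof (induction n)
    case (Suc n)
    then show ?case using le[of "(h ^^ n) y"] by (auto simp: e_def)
  qed (use y in \<open>simp add: e_def\<close>)
  have dseq: "decseq e"
    by (rule decseq_SucI) (use le e_lt in \<open>auto simp: e_def\<close>)
  have nonneg: "0 \<le> e n" for n by (simp add: e_def)
  then obtain L where L: "e \<longlonglongrightarrow> L" "\<And>n. L \<le> e n"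
    using decseq_convergent[OF dseq, of 0] by metis
  have "L \<ge> 0" by (rule LIMSEQ_le_const[OF L(1)]) (use nonneg in auto)
  moreover have "\<not> L > 0"
  proof
    assume "L > 0"
    define K where "K = {x - e 0..x + e 0} - {x - L<..<x + L}"
    have inK: "(h ^^ n) y \<in> K" for n
      using L(2)[of n] decseqD[OF dseq, of 0 n] unfolding K_def e_def by auto
    have "compact K" unfolding K_def by (intro compact_diff compact_Icc open_greaterThanLessThan)
    moreover have "K \<noteq> {}" using inK by blast
    moreover have "continuous_on K (\<lambda>w. \<bar>w - x\<bar> - \<bar>h w - x\<bar>)"
      by (intro continuous_intros continuous_on_subset[OF cont]) auto
    ultimately obtain w where w: "w \<in> K"
      "\<And>v. v \<in> K \<Longrightarrow> \<bar>w - x\<bar> - \<bar>h w - x\<bar> \<le> \<bar>v - x\<bar> - \<bar>h v - x\<bar>"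
      using continuous_attains_inf[of K "\<lambda>w. \<bar>w - x\<bar> - \<bar>h w - x\<bar>"] by blast
    define \<mu> where "\<mu> = \<bar>w - x\<bar> - \<bar>h w - x\<bar>"
    have "\<mu> > 0" using dec[of w] w(1) \<open>L > 0\<close> e_lt[of 0] by (auto simp: \<mu>_def K_def)
    have "e (Suc n) \<le> e n - \<mu>" for n
      using w(2)[OF inK[of n]] by (simp add: e_def \<mu>_def)
    then have "L \<le> L - \<mu>"
      by (intro LIMSEQ_le[OF LIMSEQ_Suc[OF L(1)] tendsto_diff[OF L(1) tendsto_const]]) auto
    with \<open>\<mu> > 0\<close> show False by simp
  qed
  ultimately have "e \<longlonglongrightarrow> 0" using L(1) by auto
  then have "(\<lambda>n. (h ^^ n) y - x) \<longlonglongrightarrow> 0"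
    unfolding e_def by (rule tendsto_rabs_zero_cancel)
  then show ?thesis by (simp add: LIM_zero_iff)
qed

lemma tendsto_of_even_odd_subsequences:
  fixes X :: "nat \<Rightarrow> 'a::topological_space"
  assumes "(\<lambda>n. X (2 * n)) \<longlonglongrightarrow> l" "(\<lambda>n. X (Suc (2 * n))) \<longlonglongrightarrow> l"
  shows "X \<longlonglongrightarrow> l"
proof (rule topological_tendstoI)
  fix S assume "open S" "l \<in> S"
  obtain M where M: "\<And>n. n \<ge> M \<Longrightarrow> X (2 * n) \<in> S"
    using topological_tendstoD[OF assms(1) \<open>open S\<close> \<open>l \<in> S\<close>] unfolding eventually_sequentially by blast
  obtain N where N: "\<And>n. n \<ge> N \<Longrightarrow> X (Suc (2 * n)) \<in> S"
    using topological_tendstoD[OF assms(2) \<open>open S\<close> \<open>l \<in> S\<close>] unfolding eventually_sequentially by blast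
  show "\<forall>\<^sub>F n in sequentially. X n \<in> S"
  proof (rule eventually_sequentiallyI)
    fix n assume n: "n \<ge> 2 * M + 2 * N + 1"
    show "X n \<in> S"
    proof (cases "even n")
      case True
      then obtain k where "n = 2 * k" by blast
      with n M[of k] show ?thesis by auto
    next
      case False
      then obtain k where "n = Suc (2 * k)" by (metis oddE Suc_eq_plus1)
      with n N[of k] show ?thesis by auto
    qed
  qed
qed

lemma isCont_real_bound:
  fixes f :: "real \<Rightarrow> real"
  assumes "isCont f x" "\<epsilon> > 0"
  obtains s where "s > 0" "\<And>y. \<bar>y - x\<bar> < s \<Longrightarrow> \<bar>f y - f x\<bar> < \<epsilon>"
proof -
  obtain s where s: "s > 0" "\<And>y. y \<noteq> x \<Longrightarrow> \<bar>y - x\<bar> < s \<Longrightarrow> \<bar>f y - f x\<bar> < \<epsilon>"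
    using assms unfolding isCont_def LIM_def dist_real_def by blast
  then have "\<bar>f y - f x\<bar> < \<epsilon>" if "\<bar>y - x\<bar> < s" for y
    using that assms(2) by (cases "y = x") auto
  with s(1) that show ?thesis by blast
qed

text \<open>Contraction is imposed on the second iterate of \<open>f\<close> because at multiplier
  -1 a single application may increase the distance. Even iterates are then controlled directly, odd
  ones by continuity of \<open>f\<close> at \<open>x\<close>.\<close>

lemma asymptotically_stable_of_second_iterate:
  fixes g f :: "real \<Rightarrow> real"
  assumes f: "f = g ^^ 3" and cont: "continuous_on UNIV f" and fixp: "f x = x" and "\<rho> > 0"
    and dec: "\<And>y. 0 < \<bar>y - x\<bar> \<Longrightarrow> \<bar>y - x\<bar> < \<rho> \<Longrightarrow> \<bar>f (f y) - x\<bar> < \<bar>y - x\<bar>"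
  shows "lyapunov_stable3 g x \<and> attracting3 g x"
proof
  have iter: "g ^^ (3 * t) = f ^^ t" for t
    by (simp add: f funpow_mult)
  have even: "(f ^^ (2 * n)) y = ((\<lambda>w. f (f w)) ^^ n) y" for n y
    by (induction n) auto
  have bound: "\<bar>(f ^^ (2 * n)) y - x\<bar> \<le> \<bar>y - x\<bar>" if y: "\<bar>y - x\<bar> < \<rho>" for n y
  proof (induction n)
    case (Suc n)
    show ?case
      using Suc y dec[of "(f ^^ (2 * n)) y"] fixp by (cases "(f ^^ (2 * n)) y = x") auto
  qed simp
  show "lyapunov_stable3 g x"
    unfolding lyapunov_stable3_def iter
  proof (intro allI impI)
    fix \<epsilon> :: real assume "\<epsilon> > 0"
    moreover have "isCont f x"
      using cont by (simp add: continuous_on_eq_continuous_at)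
    ultimately obtain s where s: "s > 0" "\<And>y. \<bar>y - x\<bar> < s \<Longrightarrow> \<bar>f y - x\<bar> < \<epsilon>"
      using isCont_real_bound[where f = f and x = x and \<epsilon> = \<epsilon>] fixp by metis
    show "\<exists>\<eta>>0. \<forall>x0. \<bar>x0 - x\<bar> < \<eta> \<longrightarrow> (\<forall>t. \<bar>(f ^^ t) x0 - x\<bar> < \<epsilon>)"
    \<comment> \<open>\<open>\<rho>\<close> makes \<open>bound\<close> applicable,
      \<open>\<epsilon>\<close> serves the even iterates, and \<open>s\<close> the odd ones, which
      lie one application of \<open>f\<close> after an even one.\<close>
    proof (intro exI[of _ "min s (min \<epsilon> \<rho>)"] conjI allI impI)
      show "min s (min \<epsilon> \<rho>) > 0" using s \<open>\<epsilon> > 0\<close> \<open>\<rho> > 0\<close> by simp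
      fix y t assume y: "\<bar>y - x\<bar> < min s (min \<epsilon> \<rho>)"
      show "\<bar>(f ^^ t) y - x\<bar> < \<epsilon>"
      proof (cases "even t")
        case True
        then obtain k where "t = 2 * k" by blast
        with bound[of y k] y show ?thesis by auto
      next
        case False
        then obtain k where "t = Suc (2 * k)" by (metis oddE Suc_eq_plus1)
        with bound[of y k] y s(2)[of "(f ^^ (2 * k)) y"] show ?thesis by auto
      qed
    qed
  qed
  show "attracting3 g x"
    unfolding attracting3_def iter
  proof (intro exI[of _ \<rho>] conjI allI impI \<open>\<rho> > 0\<close>)
    fix y assume y: "\<bar>y - x\<bar> < \<rho>"
    have "continuous_on UNIV (\<lambda>w. f (f w))"
      by (rule continuous_on_compose2[OF cont cont]) simp
    then have ev: "(\<lambda>n. (f ^^ (2 * n)) y) \<longlonglongrightarrow> x"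
      unfolding even by (rule iterates_tendsto_fixed_point) (use dec fixp y in auto)
    have "isCont f x"
      using cont by (simp add: continuous_on_eq_continuous_at)
    then have "(\<lambda>n. f ((f ^^ (2 * n)) y)) \<longlonglongrightarrow> f x"
      using ev by (rule isCont_tendsto_compose)
    then have "(\<lambda>n. (f ^^ Suc (2 * n)) y) \<longlonglongrightarrow> x" by (simp add: fixp)
    with ev show "(\<lambda>t. (f ^^ t) y) \<longlonglongrightarrow> x" by (rule tendsto_of_even_odd_subsequences)
  qed
qed

text \<open>Stability with tolerance \<open>\<rho>\<close> would confine an orbit starting near
  \<open>x\<close> to the region of expansion, where its distance to \<open>x\<close> grows at least
  like \<open>l ^ t\<close>.\<close>

lemma not_lyapunov_stable_if_expanding:
  fixes g f :: "real \<Rightarrow> real"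
  assumes f: "f = g ^^ 3" and "\<rho> > 0" "l > 1"
    and exp: "\<And>y. \<bar>y - x\<bar> < \<rho> \<Longrightarrow> l * \<bar>y - x\<bar> \<le> \<bar>f y - x\<bar>"
  shows "\<not> lyapunov_stable3 g x"
proof
  have iter: "g ^^ (3 * t) = f ^^ t" for t
    by (simp add: f funpow_mult)
  assume "lyapunov_stable3 g x"
  then obtain \<eta> where \<eta>: "\<eta> > 0" "\<And>y t. \<bar>y - x\<bar> < \<eta> \<Longrightarrow> \<bar>(f ^^ t) y - x\<bar> < \<rho>"
    unfolding lyapunov_stable3_def iter using \<open>\<rho> > 0\<close> by blast
  define y where "y = x + \<eta> / 2"
  have y: "\<bar>y - x\<bar> = \<eta> / 2" "\<bar>y - x\<bar> < \<eta>" using \<eta>(1) by (auto simp: y_def)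
  have grow: "l ^ t * (\<eta> / 2) \<le> \<bar>(f ^^ t) y - x\<bar>" for t
  proof (induction t)
    case (Suc t)
    have "l ^ Suc t * (\<eta> / 2) \<le> l * \<bar>(f ^^ t) y - x\<bar>"
      using Suc \<open>l > 1\<close> by simp
    also have "\<dots> \<le> \<bar>f ((f ^^ t) y) - x\<bar>" by (rule exp[OF \<eta>(2)[OF y(2)]])
    finally show ?case by simp
  qed (simp add: y)
  obtain t where "\<rho> / (\<eta> / 2) < l ^ t" using real_arch_pow[OF \<open>l > 1\<close>] by blast
  then have "\<rho> < l ^ t * (\<eta> / 2)" using \<eta>(1) by (simp add: field_simps)
  with grow[of t] \<eta>(2)[OF y(2), of t] show False by simp
qed

text \<open>Near \<open>x\<close> the difference quotient is within \<open>\<epsilon>\<close> of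
  \<open>m\<close>. The lower bound serves multipliers below -1, the upper bound those of modulus
  below 1.\<close>

lemma fixed_point_difference_quotient:
  fixes f :: "real \<Rightarrow> real"
  assumes "(f has_real_derivative m) (at x)" "f x = x" "\<epsilon> > 0"
  obtains \<rho> where "\<rho> > 0"
    "\<And>y. \<bar>y - x\<bar> < \<rho> \<Longrightarrow> (\<bar>m\<bar> - \<epsilon>) * \<bar>y - x\<bar> \<le> \<bar>f y - x\<bar>"
    "\<And>y. \<bar>y - x\<bar> < \<rho> \<Longrightarrow> \<bar>f y - x\<bar> \<le> (\<bar>m\<bar> + \<epsilon>) * \<bar>y - x\<bar>"
proof -
  have "((\<lambda>y. (f y - f x) / (y - x)) \<longlongrightarrow> m) (at x)"
    using assms(1) by (simp add: has_field_derivative_iff)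
  then obtain \<rho> where \<rho>: "\<rho> > 0"
    "\<And>y. y \<noteq> x \<Longrightarrow> \<bar>y - x\<bar> < \<rho> \<Longrightarrow> \<bar>(f y - x) / (y - x) - m\<bar> < \<epsilon>"
    using \<open>\<epsilon> > 0\<close> unfolding LIM_def dist_real_def \<open>f x = x\<close> by blast
  have "(\<bar>m\<bar> - \<epsilon>) * \<bar>y - x\<bar> \<le> \<bar>f y - x\<bar> \<and> \<bar>f y - x\<bar> \<le> (\<bar>m\<bar> + \<epsilon>) * \<bar>y - x\<bar>"
    if y: "\<bar>y - x\<bar> < \<rho>" for y
  proof (cases "y = x")
    case False
    define k where "k = (f y - x) / (y - x)"
    have "\<bar>m\<bar> - \<epsilon> \<le> \<bar>k\<bar>" "\<bar>k\<bar> \<le> \<bar>m\<bar> + \<epsilon>" using \<rho>(2)[OF False y] unfolding k_def[symmetric] by linarith+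
    moreover have "\<bar>f y - x\<bar> = \<bar>k\<bar> * \<bar>y - x\<bar>"
      using False by (simp add: k_def)
    ultimately show ?thesis by (simp add: mult_right_mono)
  qed (simp add: assms(2))
  with \<rho>(1) that show ?thesis by blast
qed

text \<open>With \<open>F u = u * \<phi> u\<close> and \<open>\<phi> = -1 + A u + B u\<^sup>2 + \<dots>\<close> one has
  \<open>F (F u) = u * (1 - u\<^sup>2 * W u)\<close>, where \<open>W\<close> is continuous with \<open>W 0 = 2 * (A\<^sup>2 + B)\<close>.\<close>

lemma second_iterate_contracts_at_flip:
  fixes F R :: "real \<Rightarrow> real"
  assumes F: "\<And>u. F u = u * (- 1 + A * u + B * u\<^sup>2 + u ^ 3 * R u)"
    and R: "continuous_on UNIV R" and AB: "A\<^sup>2 + B > 0"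
  obtains \<rho> where "\<rho> > 0" "\<And>u. 0 < \<bar>u\<bar> \<Longrightarrow> \<bar>u\<bar> < \<rho> \<Longrightarrow> \<bar>F (F u)\<bar> < \<bar>u\<bar>"
proof -
  define \<psi> where "\<psi> u = A + B * u + u\<^sup>2 * R u" for u
  define \<phi> where "\<phi> u = - 1 + u * \<psi> u" for u
  define W where "W u = B * (1 - \<phi> u) + u * R u - u * (\<phi> u)\<^sup>2 * R (u * \<phi> u)
      + \<psi> u * \<psi> (u * \<phi> u) - \<phi> u * \<psi> u * \<psi> (u * \<phi> u)" for u
  have F_eq: "F u = u * \<phi> u" for u
    by (simp add: F \<phi>_def \<psi>_def algebra_simps power2_eq_square power3_eq_cube)
  have FF: "F (F u) = u * (1 - u\<^sup>2 * W u)" for u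
  proof -
    have "F (F u) = u * (\<phi> u * \<phi> (u * \<phi> u))" by (simp add: F_eq)
    also have "\<phi> u * \<phi> (u * \<phi> u) = 1 - u * \<psi> u - u * \<phi> u * \<psi> (u * \<phi> u) + u\<^sup>2 * \<phi> u * \<psi> u * \<psi> (u * \<phi> u)"
      by (subst (1 2) \<phi>_def) (simp add: algebra_simps power2_eq_square)
    also have "\<dots> = 1 - u * (\<psi> u - \<psi> (u * \<phi> u)) - u\<^sup>2 * (\<psi> u * \<psi> (u * \<phi> u) - \<phi> u * \<psi> u * \<psi> (u * \<phi> u))"
    proof -
      have "u * \<phi> u * \<psi> (u * \<phi> u) = - u * \<psi> (u * \<phi> u) + u\<^sup>2 * \<psi> u * \<psi> (u * \<phi> u)"
        by (subst (1) \<phi>_def) (simp add: algebra_simps power2_eq_square)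
      then show ?thesis by (simp add: algebra_simps)
    qed
    \<comment> \<open>The constant \<open>A\<close> cancels, which yields the second factor
      \<open>u\<close> in the deviation from the identity.\<close>
    also have "\<psi> u - \<psi> (u * \<phi> u) = u * (B * (1 - \<phi> u) + u * R u - u * (\<phi> u)\<^sup>2 * R (u * \<phi> u))"
      by (simp add: \<psi>_def[of u] \<psi>_def[of "u * \<phi> u"] algebra_simps power2_eq_square)
    finally show ?thesis by (simp add: W_def algebra_simps power2_eq_square)
  qed
  have c1: "continuous_on UNIV \<psi>"
    unfolding \<psi>_def by (intro continuous_intros R)
  have c2: "continuous_on UNIV \<phi>"
    unfolding \<phi>_def by (intro continuous_intros c1)
  have c3: "continuous_on UNIV (\<lambda>u. u * \<phi> u)"
    by (intro continuous_intros c2)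
  have c4: "continuous_on UNIV (\<lambda>u. R (u * \<phi> u))" "continuous_on UNIV (\<lambda>u. \<psi> (u * \<phi> u))"
    by (rule continuous_on_compose2[OF R c3] continuous_on_compose2[OF c1 c3], simp)+
  have c5: "continuous_on UNIV W"
    unfolding W_def by (intro continuous_intros R c1 c2 c4)
  have "continuous_on UNIV (\<lambda>u. u\<^sup>2 * W u)"
    by (intro continuous_intros c5)
  with c5 have W: "isCont (\<lambda>u. u\<^sup>2 * W u) 0" "isCont W 0"
    by (simp_all add: continuous_on_eq_continuous_at)
  have "W 0 > 0" using AB by (simp add: W_def \<phi>_def \<psi>_def power2_eq_square)
  \<comment> \<open>\<open>d\<close> keeps \<open>W\<close> positive and \<open>d'\<close> keeps
    \<open>u\<^sup>2 * W u\<close> below 1, so the factor \<open>1 - u\<^sup>2 * W u\<close> lies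
    strictly between 0 and 1.\<close>
  then obtain d where d: "d > 0" "\<And>u. \<bar>u\<bar> < d \<Longrightarrow> W u > 0"
    using isCont_real_bound[OF W(2) \<open>W 0 > 0\<close>] by (metis abs_diff_less_iff diff_self diff_zero)
  obtain d' where d': "d' > 0" "\<And>u. \<bar>u\<bar> < d' \<Longrightarrow> \<bar>u\<^sup>2 * W u\<bar> < 1"
    using isCont_real_bound[OF W(1) zero_less_one] by auto
  show ?thesis
  proof (rule that[of "min d d'"])
    fix u :: real assume u: "0 < \<bar>u\<bar>" "\<bar>u\<bar> < min d d'"
    have "u\<^sup>2 * W u > 0" "u\<^sup>2 * W u < 1" using u d(2)[of u] d'(2)[of u] by auto
    then have "\<bar>1 - u\<^sup>2 * W u\<bar> < 1" by auto
    then show "\<bar>F (F u)\<bar> < \<bar>u\<bar>" unfolding FF abs_mult using u by simp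
  qed (use d d' in simp)
qed

section \<open>Stability of a 3-cycle of a quadratic map\<close>

text \<open>In the case \<open>k1 * k2 * k3 = -1\<close>, the quantity \<open>A\<^sup>2 + B\<close> is \<open>-1/6\<close> of the Schwarzian derivative
  of the third iterate, and the chain rule for the Schwarzian writes it as a sum of squares.\<close>

lemma quadratic_three_cycle_asymptotically_stable_iff:
  fixes a b c x y z m :: real and g :: "real \<Rightarrow> real"
  assumes a: "a \<noteq> 0" and g: "g = (\<lambda>t. a * t\<^sup>2 + b * t + c)"
    and cyc: "g x = y" "g y = z" "g z = x"
    and m: "m = (2 * a * x + b) * (2 * a * y + b) * (2 * a * z + b)" and "m < 1"
  shows "lyapunov_stable3 g x \<and> attracting3 g x \<longleftrightarrow> - 1 \<le> m"
proof -
  define f where "f = g ^^ 3"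
  have f: "f t = g (g (g t))" for t by (simp add: f_def numeral_3_eq_3)
  have fx: "f x = x" by (simp add: f cyc)
  have cont_g: "continuous_on UNIV g" unfolding g by (intro continuous_intros)
  have cont: "continuous_on UNIV f"
    unfolding f by (intro continuous_on_compose2[OF cont_g] cont_g) auto
  have dg: "(g has_real_derivative 2 * a * t + b) (at t)" for t
    unfolding g by (auto intro!: derivative_eq_intros)
  have "((\<lambda>t. g (g t)) has_real_derivative (2 * a * y + b) * (2 * a * x + b)) (at x)"
    by (rule DERIV_chain2[where f = g and g = g]) (simp_all add: cyc dg)
  then have "((\<lambda>t. g (g (g t))) has_real_derivative
      (2 * a * z + b) * ((2 * a * y + b) * (2 * a * x + b))) (at x)"
    by (rule DERIV_chain2[where f = g and g = "\<lambda>t. g (g t)", rotated]) (simp add: cyc dg)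
  then have df: "(f has_real_derivative m) (at x)"
    unfolding m by (simp add: f[abs_def] mult_ac)
  \<comment> \<open>Only at \<open>m = - 1\<close> does the derivative alone fail to decide
    stability.\<close>
  consider "m < - 1" | "m = - 1" | "\<bar>m\<bar> < 1" using \<open>m < 1\<close> by linarith
  then show ?thesis
  proof cases
    case 1
    define \<epsilon> where "\<epsilon> = (\<bar>m\<bar> - 1) / 2"
    have "\<epsilon> > 0" "\<bar>m\<bar> - \<epsilon> > 1" using 1 by (auto simp: \<epsilon>_def field_simps)
    moreover obtain \<rho> where "\<rho> > 0" "\<And>y. \<bar>y - x\<bar> < \<rho> \<Longrightarrow> (\<bar>m\<bar> - \<epsilon>) * \<bar>y - x\<bar> \<le> \<bar>f y - x\<bar>"
      using fixed_point_difference_quotient[OF df fx \<open>\<epsilon> > 0\<close>] by blast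
    ultimately have "\<not> lyapunov_stable3 g x"
      using not_lyapunov_stable_if_expanding[OF f_def] by blast
    then show ?thesis using 1 by simp
  next
    case 2
    define k1 k2 k3 where "k1 = 2 * a * x + b" and "k2 = 2 * a * y + b" and "k3 = 2 * a * z + b"
    \<comment> \<open>\<open>A\<close> and \<open>B\<close> are the coefficients of
      \<open>u\<^sup>2\<close> and \<open>u ^ 3\<close> in \<open>f (x + u) - x\<close>, and
      \<open>R\<close> collects the higher ones. \<open>w u\<close> is the displacement after two
      steps of \<open>g\<close>, with \<open>v2\<close> and \<open>v3\<close> its successive
      tails.\<close>
    define A where "A = a * (k3 * k2 + k3 * k1\<^sup>2 + k1\<^sup>2 * k2\<^sup>2)"
    define B where "B = 2 * a\<^sup>2 * (k1 * k3 + k1 * k2 * (k2 + k1\<^sup>2))"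
    define v3 where "v3 u = 2 * a\<^sup>2 * k1 + a ^ 3 * u" for u
    define v2 where "v2 u = a * (k2 + k1\<^sup>2) + u * v3 u" for u
    define w where "w u = k1 * k2 * u + u\<^sup>2 * v2 u" for u
    define R where "R u = k3 * a ^ 3 + 2 * a * k1 * k2 * v3 u + a * (v2 u)\<^sup>2" for u
    have k: "k1 * k2 * k3 = - 1" using m 2 by (simp add: k1_def k2_def k3_def)
    have step: "g (s + v) = g s + ((2 * a * s + b) * v + a * v\<^sup>2)" for s v
      unfolding g by algebra
    have F: "f (x + u) - x = u * (- 1 + A * u + B * u\<^sup>2 + u ^ 3 * R u)" for u
    proof -
      have "g (x + u) = y + (k1 * u + a * u\<^sup>2)" by (simp add: step cyc k1_def)
      moreover have "g (y + (k1 * u + a * u\<^sup>2)) = z + w u"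
        unfolding step cyc w_def v2_def v3_def k2_def[symmetric]
        by (simp add: algebra_simps power2_eq_square power3_eq_cube)
      moreover have "g (z + w u) = x + (k3 * w u + a * (w u)\<^sup>2)"
        by (simp add: step cyc k3_def)
      ultimately have "f (x + u) - x = k3 * w u + a * (w u)\<^sup>2" by (simp add: f)
      also have "\<dots> = k1 * k2 * k3 * u + u\<^sup>2 * (k3 * v2 u + a * k1\<^sup>2 * k2\<^sup>2)
          + 2 * a * k1 * k2 * u ^ 3 * v2 u + a * u ^ 4 * (v2 u)\<^sup>2"
        by (simp add: w_def algebra_simps power2_eq_square power3_eq_cube power4_eq_xxxx)
      also have "\<dots> = - u + A * u\<^sup>2 + u ^ 3 * (k3 * v3 u + 2 * a * k1 * k2 * v2 u) + a * u ^ 4 * (v2 u)\<^sup>2"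
        unfolding k by (simp add: v2_def[of u] A_def algebra_simps power2_eq_square power3_eq_cube)
      also have "k3 * v3 u + 2 * a * k1 * k2 * v2 u = B + u * (k3 * a ^ 3 + 2 * a * k1 * k2 * v3 u)"
        by (simp add: v3_def[of u] v2_def[of u] B_def algebra_simps power2_eq_square power3_eq_cube)
      finally show ?thesis
        by (simp add: R_def algebra_simps power2_eq_square power3_eq_cube power4_eq_xxxx)
    qed
    \<comment> \<open>Every mixed term of \<open>A\<^sup>2\<close> contains the factor
      \<open>k1 * k2 * k3 = - 1\<close>; together the mixed terms equal \<open>- B\<close>, so only
      the squares survive.\<close>
    have "A\<^sup>2 + B = a\<^sup>2 * ((k2 * k3)\<^sup>2 + (k1\<^sup>2 * k3)\<^sup>2 + (k1\<^sup>2 * k2\<^sup>2)\<^sup>2)"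
    proof -
      have "A\<^sup>2 = a\<^sup>2 * ((k2 * k3)\<^sup>2 + (k1\<^sup>2 * k3)\<^sup>2 + (k1\<^sup>2 * k2\<^sup>2)\<^sup>2
          + 2 * (k1 * k2 * k3) * (k1 * k3 + k1 * k2\<^sup>2 + k1 ^ 3 * k2))"
        by (simp add: A_def algebra_simps power2_eq_square power3_eq_cube)
      then show ?thesis
        unfolding k by (simp add: B_def algebra_simps power2_eq_square power3_eq_cube)
    qed
    moreover have "k2 * k3 \<noteq> 0" using k by auto
    ultimately have AB: "A\<^sup>2 + B > 0"
      using a by (simp add: add_pos_nonneg)
    have "continuous_on UNIV R" unfolding R_def v2_def v3_def by (intro continuous_intros)
    then obtain \<rho> where \<rho>: "\<rho> > 0"
      "\<And>u. 0 < \<bar>u\<bar> \<Longrightarrow> \<bar>u\<bar> < \<rho> \<Longrightarrow> \<bar>f (x + (f (x + u) - x)) - x\<bar> < \<bar>u\<bar>"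
      using second_iterate_contracts_at_flip[of "\<lambda>u. f (x + u) - x", OF F _ AB] by blast
    have "\<bar>f (f y) - x\<bar> < \<bar>y - x\<bar>" if "0 < \<bar>y - x\<bar>" "\<bar>y - x\<bar> < \<rho>" for y
      using \<rho>(2)[OF that] by simp
    then show ?thesis
      using asymptotically_stable_of_second_iterate[OF f_def cont fx \<rho>(1)] 2 by simp
  next
    case 3
    define \<epsilon> where "\<epsilon> = (1 - \<bar>m\<bar>) / 2"
    have \<epsilon>: "\<epsilon> > 0" "\<bar>m\<bar> + \<epsilon> < 1" using 3 by (auto simp: \<epsilon>_def field_simps)
    obtain \<rho> where \<rho>: "\<rho> > 0" "\<And>y. \<bar>y - x\<bar> < \<rho> \<Longrightarrow> \<bar>f y - x\<bar> \<le> (\<bar>m\<bar> + \<epsilon>) * \<bar>y - x\<bar>"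
      using fixed_point_difference_quotient[OF df fx \<epsilon>(1)] by blast
    have lt: "\<bar>f y - x\<bar> < \<bar>y - x\<bar>" if "0 < \<bar>y - x\<bar>" "\<bar>y - x\<bar> < \<rho>" for y
    proof -
      have "(\<bar>m\<bar> + \<epsilon>) * \<bar>y - x\<bar> < 1 * \<bar>y - x\<bar>"
        using \<epsilon>(2) that(1) by (intro mult_strict_right_mono)
      with \<rho>(2)[OF that(2)] show ?thesis by simp
    qed
    have "\<bar>f (f y) - x\<bar> < \<bar>y - x\<bar>" if "0 < \<bar>y - x\<bar>" "\<bar>y - x\<bar> < \<rho>" for y
      using lt[OF that] lt[of "f y"] that fx by (cases "f y = x") auto
    then show ?thesis
      using asymptotically_stable_of_second_iterate[OF f_def cont fx \<rho>(1)] 3 by force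
  qed
qed

section \<open>The roots of the cubic\<close>

text \<open>Solving \<open>poly (Q \<beta>) t = 0\<close> for \<open>\<beta>\<close> gives a function of \<open>t\<close> that increases strictly on each of the
  three intervals cut out by its poles -1 and 0; each interval contains one root.\<close>

definition root_param :: "real \<Rightarrow> real" where
  "root_param t = t - 1 / t - 1 / (t + 1)"

definition same_branch :: "real \<Rightarrow> real \<Rightarrow> bool" where
  "same_branch s t \<longleftrightarrow> s < - 1 \<and> t < - 1 \<or> - 1 < s \<and> s < 0 \<and> - 1 < t \<and> t < 0 \<or> 0 < s \<and> 0 < t"

lemma poly_Q: "poly (Q \<beta>) t = t ^ 3 + (1 - \<beta>) * t\<^sup>2 - (2 + \<beta>) * t - 1"
  by (simp add: Q_def power3_eq_cube power2_eq_square algebra_simps)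

text \<open>Multiplying \<open>root_param t - \<beta>\<close> by \<open>t * (t + 1)\<close> clears
  the denominators and gives the cubic. At the poles 0 and -1 the cubic takes the values -1 and
  1.\<close>

lemma poly_Q_eq_0_iff: "poly (Q \<beta>) t = 0 \<longleftrightarrow> t \<noteq> 0 \<and> t \<noteq> - 1 \<and> root_param t = \<beta>"
proof (cases "t = 0 \<or> t = - 1")
  case True
  then show ?thesis by (auto simp: poly_Q)
next
  case False
  then have nz: "t \<noteq> 0" "t + 1 \<noteq> 0" by auto
  define i j where "i = 1 / t" and "j = 1 / (t + 1)"
  have "i * t = 1" "j * (t + 1) = 1" using nz by (auto simp: i_def j_def)
  then have "poly (Q \<beta>) t = (t - i - j - \<beta>) * (t * (t + 1))"
    unfolding poly_Q by algebra
  then have "poly (Q \<beta>) t = (root_param t - \<beta>) * (t * (t + 1))"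
    by (simp add: root_param_def i_def j_def)
  with nz show ?thesis by auto
qed

text \<open>Each of the three terms of \<open>root_param\<close> contributes a positive multiple of
  \<open>t - s\<close>, since on one branch \<open>s * t\<close> and
  \<open>(s + 1) * (t + 1)\<close> are positive.\<close>

lemma root_param_strict_mono:
  assumes "same_branch s t" "s < t"
  shows "root_param s < root_param t"
proof -
  have st: "s * t > 0" "(s + 1) * (t + 1) > 0" "s \<noteq> 0" "t \<noteq> 0" "s + 1 \<noteq> 0" "t + 1 \<noteq> 0"
    using assms(1) by (auto simp: same_branch_def zero_less_mult_iff)
  have "root_param t - root_param s = (t - s) + (t - s) / (s * t) + (t - s) / ((s + 1) * (t + 1))"
  proof -
    have "1 / s - 1 / t = (t - s) / (s * t)" using st by (simp add: field_simps)
    moreover have "1 / (s + 1) - 1 / (t + 1) = (t - s) / ((s + 1) * (t + 1))"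
      using st by (simp add: diff_frac_eq)
    ultimately show ?thesis by (simp add: root_param_def)
  qed
  moreover have "(t - s) / (s * t) > 0" "(t - s) / ((s + 1) * (t + 1)) > 0"
    using st assms(2) by simp_all
  ultimately show ?thesis using assms(2) by linarith
qed

lemma root_param_less_iff: "same_branch s t \<Longrightarrow> root_param s < root_param t \<longleftrightarrow> s < t"
  using root_param_strict_mono[of s t] root_param_strict_mono[of t s]
  by (cases s t rule: linorder_cases) (auto simp: same_branch_def)

lemma root_param_eq_iff: "same_branch s t \<Longrightarrow> root_param s = root_param t \<longleftrightarrow> s = t"
  using root_param_strict_mono[of s t] root_param_strict_mono[of t s]
  by (cases s t rule: linorder_cases) (auto simp: same_branch_def)

text \<open>Sign changes between \<open>- M\<close>, -1, 0 and \<open>M\<close> produce one root on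
  each branch, and injectivity of \<open>root_param\<close> on a branch excludes further ones. The
  sorted list thus has length three, which gives \<open>q\<close> its meaning.\<close>

lemma Q_roots:
  shows "{t. poly (Q \<beta>) t = 0} = {q \<beta> 1, q \<beta> 2, q \<beta> 3}"
    and "q \<beta> 1 < - 1" and "- 1 < q \<beta> 2" and "q \<beta> 2 < 0" and "0 < q \<beta> 3"
proof -
  \<comment> \<open>The margin 3 gives \<open>M + 1 - \<beta> \<ge> 4\<close> and
    \<open>2 + \<beta> \<le> M\<close>, so the leading terms fix the signs at \<open>M\<close> and
    \<open>- M\<close>.\<close>
  define M where "M = \<bar>\<beta>\<bar> + 3"
  have M: "M \<ge> 3" "M > 0" "\<bar>\<beta>\<bar> = M - 3" by (auto simp: M_def)
  have le: "4 \<le> M + 1 - \<beta>" "2 + \<beta> \<le> M" "- M + 1 - \<beta> \<le> - 2" using M by auto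
  have "M\<^sup>2 * 4 \<le> M\<^sup>2 * (M + 1 - \<beta>)" "(2 + \<beta>) * M \<le> M * M" "M\<^sup>2 * (- M + 1 - \<beta>) \<le> M\<^sup>2 * (- 2)"
    "3 * 3 \<le> M * M"
    using M(1) by (intro mult_left_mono mult_right_mono mult_mono le; simp)+
  moreover have "poly (Q \<beta>) M = M\<^sup>2 * (M + 1 - \<beta>) - (2 + \<beta>) * M - 1"
    "poly (Q \<beta>) (- M) = M\<^sup>2 * (- M + 1 - \<beta>) + (2 + \<beta>) * M - 1"
    by (simp_all add: poly_Q power3_eq_cube power2_eq_square algebra_simps)
  ultimately have far: "poly (Q \<beta>) M > 0" "poly (Q \<beta>) (- M) < 0"
    unfolding power2_eq_square by linarith+
  have near: "poly (Q \<beta>) (- 1) > 0" "poly (Q \<beta>) 0 < 0" by (auto simp: poly_Q)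
  have "- M < - 1" using M by simp
  then obtain t1 where t1: "t1 < - 1" "poly (Q \<beta>) t1 = 0"
    using poly_IVT_pos[OF _ far(2) near(1)] by blast
  obtain t2 where t2: "- 1 < t2" "t2 < 0" "poly (Q \<beta>) t2 = 0"
    using poly_IVT_neg[OF _ near] by auto
  obtain t3 where t3: "0 < t3" "poly (Q \<beta>) t3 = 0"
    using poly_IVT_pos[OF M(2) near(2) far(1)] by blast
  have "t = t1 \<or> t = t2 \<or> t = t3" if root: "poly (Q \<beta>) t = 0" for t
  proof -
    have t: "t \<noteq> 0" "t \<noteq> - 1" and eq: "root_param t = root_param t1"
      "root_param t = root_param t2" "root_param t = root_param t3"
      using root t1(2) t2(3) t3(2) by (auto simp: poly_Q_eq_0_iff)
    consider "t < - 1" | "- 1 < t" "t < 0" | "0 < t" using t by linarith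
    then show ?thesis
    proof cases
      case 1
      then have "same_branch t t1" using t1(1) by (simp add: same_branch_def)
      then show ?thesis using root_param_eq_iff eq(1) by blast
    next
      case 2
      then have "same_branch t t2" using t2 by (simp add: same_branch_def)
      then show ?thesis using root_param_eq_iff eq(2) by blast
    next
      case 3
      then have "same_branch t t3" using t3(1) by (simp add: same_branch_def)
      then show ?thesis using root_param_eq_iff eq(3) by blast
    qed
  qed
  then have set: "{t. poly (Q \<beta>) t = 0} = {t1, t2, t3}" using t1 t2 t3 by auto
  have "sorted_list_of_set {t1, t2, t3} = [t1, t2, t3]"
    using t1 t2 t3 by auto
  then have "q \<beta> 1 = t1" "q \<beta> 2 = t2" "q \<beta> 3 = t3"
    unfolding q_def set by (simp_all add: numeral_2_eq_2)
  with set t1 t2 t3 show "{t. poly (Q \<beta>) t = 0} = {q \<beta> 1, q \<beta> 2, q \<beta> 3}"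
    and "q \<beta> 1 < - 1" and "- 1 < q \<beta> 2" and "q \<beta> 2 < 0" and "0 < q \<beta> 3" by simp_all
qed

lemma root_param_q: "i \<in> {1, 2, 3} \<Longrightarrow> root_param (q \<beta> i) = \<beta>"
proof -
  assume "i \<in> {1, 2, 3}"
  then have "q \<beta> i \<in> {t. poly (Q \<beta>) t = 0}" unfolding Q_roots(1) by auto
  then show ?thesis by (simp add: poly_Q_eq_0_iff)
qed

text \<open>Comparing a root with a number reduces to evaluating \<open>root_param\<close> at that
  number, without solving the cubic.\<close>

lemma q_less_iff:
  assumes "i \<in> {1, 2, 3}" "same_branch (q \<beta> i) t"
  shows "q \<beta> i < t \<longleftrightarrow> \<beta> < root_param t"
  using root_param_less_iff[OF assms(2)] root_param_q[OF assms(1)] by simp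

lemma less_q_iff:
  assumes "i \<in> {1, 2, 3}" "same_branch (q \<beta> i) t"
  shows "t < q \<beta> i \<longleftrightarrow> root_param t < \<beta>"
  using root_param_less_iff[of t "q \<beta> i"] root_param_q[OF assms(1)] assms(2)
  by (simp add: same_branch_def conj_ac)

lemma same_branch_q:
  "t < - 1 \<Longrightarrow> same_branch (q \<beta> 1) t"
  "- 1 < t \<Longrightarrow> t < 0 \<Longrightarrow> same_branch (q \<beta> 2) t"
  "0 < t \<Longrightarrow> same_branch (q \<beta> 3) t"
  using Q_roots(2-5)[of \<beta>] by (simp_all add: same_branch_def)

text \<open>On the branch of \<open>t\<close>, the two endpoint comparisons become
  \<open>\<beta>0 < \<beta>\<close> and \<open>\<beta> \<le> \<beta>1\<close>. The other two
  intervals lie on other branches and cannot contain \<open>t\<close>.\<close>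

lemma root_in_ranges_iff:
  assumes "poly (Q \<beta>) t = 0" "\<beta>0 < \<beta>"
  shows "t \<in> {q \<beta>0 1 <.. q \<beta>1 1} \<union> {q \<beta>0 2 <.. q \<beta>1 2} \<union> {q \<beta>0 3 <.. q \<beta>1 3} \<longleftrightarrow> \<beta> \<le> \<beta>1"
proof -
  have t: "t \<noteq> 0" "t \<noteq> - 1" "root_param t = \<beta>" using assms(1) by (auto simp: poly_Q_eq_0_iff)
  have iff: "q \<beta>0 i < t \<and> t \<le> q \<beta>1 i \<longleftrightarrow> \<beta> \<le> \<beta>1"
    if "i \<in> {1, 2, 3}" "same_branch (q \<beta>0 i) t" "same_branch (q \<beta>1 i) t" for i
    using q_less_iff[OF that(1,2)] q_less_iff[OF that(1,3)] t(3) assms(2) by (auto simp: not_less)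
  note lim = Q_roots(2-5)[of \<beta>0] Q_roots(2-5)[of \<beta>1]
  consider "t < - 1" | "- 1 < t" "t < 0" | "0 < t" using t by linarith
  then show ?thesis
  proof cases
    case 1
    then have "\<not> q \<beta>0 2 < t" "\<not> q \<beta>0 3 < t" using lim by linarith+
    with iff[of 1] same_branch_q(1)[OF 1] show ?thesis by simp
  next
    case 2
    then have "\<not> t \<le> q \<beta>1 1" "\<not> q \<beta>0 3 < t" using lim by linarith+
    with iff[of 2] same_branch_q(2)[OF 2] show ?thesis by simp
  next
    case 3
    then have "\<not> t \<le> q \<beta>1 1" "\<not> t \<le> q \<beta>1 2" using lim by linarith+
    with iff[of 3] same_branch_q(3)[OF 3] show ?thesis by simp
  qed
qed

section \<open>The critical parameter\<close>

text \<open>The difference is \<open>t - s\<close> times a sum of squares and a positive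
  constant.\<close>

lemma critical_cubic_strict_mono:
  fixes s t :: real
  assumes "s < t"
  shows "s ^ 3 + s\<^sup>2 + 7 * s - 2 < t ^ 3 + t\<^sup>2 + 7 * t - 2"
proof -
  have "(t ^ 3 + t\<^sup>2 + 7 * t - 2) - (s ^ 3 + s\<^sup>2 + 7 * s - 2)
      = (t - s) * ((t + s + 1)\<^sup>2 / 2 + t\<^sup>2 / 2 + s\<^sup>2 / 2 + 13 / 2)"
    by (simp add: power3_eq_cube power2_eq_square field_simps)
  moreover have "(t + s + 1)\<^sup>2 / 2 + t\<^sup>2 / 2 + s\<^sup>2 / 2 + 13 / 2 > 0"
    by (intro add_nonneg_pos add_nonneg_nonneg) auto
  ultimately show ?thesis using assms by (smt (verit) mult_pos_pos)
qed

text \<open>The definite description is justified by a sign change on the interval from 0 to 1 and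
  by strict monotonicity.\<close>

lemma \<beta>_crit_root: "\<beta>_crit ^ 3 + \<beta>_crit\<^sup>2 + 7 * \<beta>_crit - 2 = 0"
proof -
  obtain s :: real where "s ^ 3 + s\<^sup>2 + 7 * s - 2 = 0"
    using poly_IVT_pos[of 0 1 "[:-2, 7, 1, 1:] :: real poly"]
    by (auto simp: power3_eq_cube power2_eq_square algebra_simps)
  moreover have "t = s" if "t ^ 3 + t\<^sup>2 + 7 * t - 2 = 0" for t
    using that calculation critical_cubic_strict_mono[of s t] critical_cubic_strict_mono[of t s]
    by linarith
  ultimately show ?thesis unfolding \<beta>_crit_def by (rule theI[of "\<lambda>t. t ^ 3 + t\<^sup>2 + 7 * t - 2 = 0"])
qed

lemma le_\<beta>_crit_iff: "t \<le> \<beta>_crit \<longleftrightarrow> t ^ 3 + t\<^sup>2 + 7 * t - 2 \<le> 0"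
  using critical_cubic_strict_mono[of \<beta>_crit t] critical_cubic_strict_mono[of t \<beta>_crit] \<beta>_crit_root
  by (cases t \<beta>_crit rule: linorder_cases) auto

lemma \<beta>_crit_bounds: "0.2722 < \<beta>_crit" "\<beta>_crit < 0.2723"
proof -
  show "\<beta>_crit < 0.2723"
    using le_\<beta>_crit_iff[of "0.2723"] by (simp add: power3_eq_cube power2_eq_square)
  \<comment> \<open>The criterion yields only a weak lower bound, so a slightly larger number is
    tested to obtain the strict one.\<close>
  have "0.27221 \<le> \<beta>_crit"
    using le_\<beta>_crit_iff[of "0.27221"] by (simp add: power3_eq_cube power2_eq_square)
  then show "0.2722 < \<beta>_crit" by simp
qed

section \<open>Decimal digits of the interval ends\<close>

lemma decimal_trunc_eq:
  assumes "of_int k / 10 ^ n \<le> \<bar>x\<bar>" "\<bar>x\<bar> < (of_int k + 1) / 10 ^ n"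
  shows "decimal_trunc n x = sgn x * of_int k / 10 ^ n"
proof -
  have "\<lfloor>\<bar>x\<bar> * 10 ^ n\<rfloor> = k"
    using assms by (intro floor_unique) (simp_all add: field_simps)
  then show ?thesis by (simp add: decimal_trunc_def)
qed

text \<open>Each root is enclosed between neighbouring multiples of 0.001 by comparing rational
  values of \<open>root_param\<close> with 0 or with the bounds on \<open>\<beta>_crit\<close>.
  Truncation is towards zero, so for a negative root the digits are those of the upper end.\<close>

lemma decimal_expansions:
  "decimal_trunc 3 (q 0 1) = - 1.801" "decimal_trunc 3 (q \<beta>_crit 1) = - 1.713"
  "decimal_trunc 3 (q 0 2) = - 0.445" "decimal_trunc 3 (q \<beta>_crit 2) = - 0.416"
  "decimal_trunc 3 (q 0 3) = 1.246" "decimal_trunc 3 (q \<beta>_crit 3) = 1.401"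
proof -
  have q1: "s < q \<beta> 1 \<and> q \<beta> 1 < t"
    if "s < - 1" "t < - 1" "root_param s < \<beta>" "\<beta> < root_param t" for \<beta> s t
    using that less_q_iff[of 1] q_less_iff[of 1] same_branch_q(1) by blast
  have q2: "s < q \<beta> 2 \<and> q \<beta> 2 < t"
    if "- 1 < s" "s < 0" "- 1 < t" "t < 0" "root_param s < \<beta>" "\<beta> < root_param t" for \<beta> s t
    using that less_q_iff[of 2] q_less_iff[of 2] same_branch_q(2) by blast
  have q3: "s < q \<beta> 3 \<and> q \<beta> 3 < t"
    if "0 < s" "0 < t" "root_param s < \<beta>" "\<beta> < root_param t" for \<beta> s t
    using that less_q_iff[of 3] q_less_iff[of 3] same_branch_q(3) by blast
  have "- 1.802 < q 0 1 \<and> q 0 1 < - 1.801"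
    by (rule q1) (simp_all add: root_param_def)
  then show "decimal_trunc 3 (q 0 1) = - 1.801"
    using decimal_trunc_eq[of 1801 3 "q 0 1"] by (simp add: abs_if sgn_if)
  have "- 1.714 < q \<beta>_crit 1 \<and> q \<beta>_crit 1 < - 1.713"
    by (rule q1) (use \<beta>_crit_bounds in \<open>simp_all add: root_param_def\<close>)
  then show "decimal_trunc 3 (q \<beta>_crit 1) = - 1.713"
    using decimal_trunc_eq[of 1713 3 "q \<beta>_crit 1"] by (simp add: abs_if sgn_if)
  have "- 0.446 < q 0 2 \<and> q 0 2 < - 0.445"
    by (rule q2) (simp_all add: root_param_def)
  then show "decimal_trunc 3 (q 0 2) = - 0.445"
    using decimal_trunc_eq[of 445 3 "q 0 2"] by (simp add: abs_if sgn_if)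
  have "- 0.417 < q \<beta>_crit 2 \<and> q \<beta>_crit 2 < - 0.416"
    by (rule q2) (use \<beta>_crit_bounds in \<open>simp_all add: root_param_def\<close>)
  then show "decimal_trunc 3 (q \<beta>_crit 2) = - 0.416"
    using decimal_trunc_eq[of 416 3 "q \<beta>_crit 2"] by (simp add: abs_if sgn_if)
  have "1.246 < q 0 3 \<and> q 0 3 < 1.247"
    by (rule q3) (simp_all add: root_param_def)
  then show "decimal_trunc 3 (q 0 3) = 1.246"
    using decimal_trunc_eq[of 1246 3 "q 0 3"] by (simp add: abs_if sgn_if)
  have "1.401 < q \<beta>_crit 3 \<and> q \<beta>_crit 3 < 1.402"
    by (rule q3) (use \<beta>_crit_bounds in \<open>simp_all add: root_param_def\<close>)
  then show "decimal_trunc 3 (q \<beta>_crit 3) = 1.401"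
    using decimal_trunc_eq[of 1401 3 "q \<beta>_crit 3"] by (simp add: abs_if sgn_if)
qed

section \<open>The cycle as an orbit on the roots\<close>

text \<open>The substitution permutes the three terms \<open>t\<close>, \<open>- 1 / t\<close> and
  \<open>- 1 / (t + 1)\<close> of \<open>root_param\<close> cyclically, up to constants that
  cancel.\<close>

lemma Q_root_shift:
  assumes "poly (Q \<beta>) t = 0"
  shows "poly (Q \<beta>) (- 1 - 1 / t) = 0"
proof -
  have t: "t \<noteq> 0" "t + 1 \<noteq> 0" "root_param t = \<beta>" using assms by (auto simp: poly_Q_eq_0_iff)
  have "- 1 - 1 / t = - (t + 1) / t" using t by (simp add: field_simps)
  then have nz: "- 1 - 1 / t \<noteq> 0" and inv: "1 / (- 1 - 1 / t) = - 1 + 1 / (t + 1)"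
    using t by (simp_all add: field_simps)
  have "root_param (- 1 - 1 / t) = root_param t"
    unfolding root_param_def inv using t(1) by simp
  with t nz show ?thesis by (simp add: poly_Q_eq_0_iff)
qed

lemma Q_root_shift_twice:
  assumes "poly (Q \<beta>) t = 0"
  shows "- 1 - 1 / (- 1 - 1 / t) = - 1 / (t + 1)" "- 1 - 1 / (- 1 / (t + 1)) = t"
proof -
  have t: "t \<noteq> 0" "t + 1 \<noteq> 0" using assms by (auto simp: poly_Q_eq_0_iff)
  have "- 1 - 1 / t = - (t + 1) / t" using t by (simp add: field_simps)
  then show "- 1 - 1 / (- 1 - 1 / t) = - 1 / (t + 1)" using t by (simp add: field_simps)
  show "- 1 - 1 / (- 1 / (t + 1)) = t" using t by (simp add: field_simps)
qed

definition cycle_point :: "real \<Rightarrow> real \<Rightarrow> real \<Rightarrow> real \<Rightarrow> real" where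
  "cycle_point a b \<beta> t = (- b + \<beta> + 1) / (2 * a) + 1 / (a * t)"

text \<open>The derivative of the quadratic map at a cycle point depends only on
  \<open>\<beta>\<close> and \<open>t\<close>, so it is a convenient coordinate for the identities
  below.\<close>

lemma cycle_point_slope:
  "a \<noteq> 0 \<Longrightarrow> 2 * a * cycle_point a b \<beta> t + b = \<beta> + 1 + 2 / t"
  by (cases "t = 0") (simp_all add: cycle_point_def field_simps)

lemma cycle_point_step:
  assumes a: "a \<noteq> 0" and disc: "b\<^sup>2 - 4 * a * c - 2 * b - 7 = \<beta>\<^sup>2" and root: "poly (Q \<beta>) t = 0"
  shows "a * (cycle_point a b \<beta> t)\<^sup>2 + b * cycle_point a b \<beta> t + c = cycle_point a b \<beta> (- 1 - 1 / t)"
proof -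
  have t: "t \<noteq> 0" "t + 1 \<noteq> 0" "root_param t = \<beta>" using root by (auto simp: poly_Q_eq_0_iff)
  define p p' where "p = cycle_point a b \<beta> t" and "p' = cycle_point a b \<beta> (- 1 - 1 / t)"
  define i j where "i = 1 / t" and "j = 1 / (t + 1)"
  have "- 1 - 1 / t = - (t + 1) / t" using t by (simp add: field_simps)
  then have "1 / (- 1 - 1 / t) = - 1 + j" using t by (simp add: j_def field_simps)
  then have p': "2 * a * p' + b = \<beta> - 1 + 2 * j"
    using cycle_point_slope[OF a, of b \<beta> "- 1 - 1 / t"] by (simp add: p'_def algebra_simps)
  have p: "2 * a * p + b = \<beta> + 1 + 2 * i"
    using cycle_point_slope[OF a, of b \<beta> t] by (simp add: p_def i_def)
  have "i * t = 1" "j * (t + 1) = 1" "t - i - j = \<beta>"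
    using t by (auto simp: i_def j_def root_param_def)
  \<comment> \<open>After completing the square, with slope \<open>2 * a * p + b\<close> as
    coordinate, the map sends \<open>v\<close> to
    \<open>(v\<^sup>2 - (\<beta>\<^sup>2 + 7)) / 2\<close>; this is the claim in that
    coordinate.\<close>
  then have "(\<beta> + 1 + 2 * i)\<^sup>2 - (\<beta>\<^sup>2 + 7) = 2 * (\<beta> - 1 + 2 * j)" by algebra
  then have "4 * a * (a * p\<^sup>2 + b * p + c) = 4 * a * p'"
    using p p' disc by algebra
  with a show ?thesis by (simp add: p_def p'_def)
qed

lemma cycle_point_inj:
  "a \<noteq> 0 \<Longrightarrow> s \<noteq> 0 \<Longrightarrow> t \<noteq> 0 \<Longrightarrow> cycle_point a b \<beta> s = cycle_point a b \<beta> t \<Longrightarrow> s = t"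
  by (simp add: cycle_point_def)

text \<open>Both differences have the numerator \<open>- (t\<^sup>2 + t + 1)\<close>, which never
  vanishes; after it cancels, only the quotient of the denominators \<open>t * (t + 1)\<close> and
  \<open>t + 1\<close> remains.\<close>

lemma cycle_point_ratio:
  assumes a: "a \<noteq> 0" and root: "poly (Q \<beta>) t = 0"
  shows "(cycle_point a b \<beta> (- 1 / (t + 1)) - cycle_point a b \<beta> (- 1 - 1 / t)) /
    (cycle_point a b \<beta> (- 1 - 1 / t) - cycle_point a b \<beta> t) = t"
proof -
  have t: "t \<noteq> 0" "t + 1 \<noteq> 0" using root by (auto simp: poly_Q_eq_0_iff)
  define D where "D = t\<^sup>2 + t + 1"
  have "D = (t + 1 / 2)\<^sup>2 + 3 / 4" by (simp add: D_def power2_eq_square algebra_simps)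
  then have D: "D \<noteq> 0" by (smt (verit) zero_le_power2 divide_pos_pos)
  have diff: "cycle_point a b \<beta> s - cycle_point a b \<beta> s' = (1 / s - 1 / s') / a" for s s'
    using a by (cases "s = 0"; cases "s' = 0") (simp_all add: cycle_point_def field_simps)
  have inv: "1 / (- 1 - 1 / t) = - t / (t + 1)"
  proof -
    have "- 1 - 1 / t = - (t + 1) / t" using t by (simp add: field_simps)
    then show ?thesis using t by (simp add: field_simps)
  qed
  have e: "1 / (- 1 / (t + 1)) - - t / (t + 1) = - D / (t + 1)" "- t / (t + 1) - 1 / t = - D / (t * (t + 1))"
    using t by (simp_all add: D_def field_simps power2_eq_square)
  show ?thesis unfolding diff inv e using t D a by simp
qed

text \<open>The factors are the slopes at the three cycle points. Their product is symmetric in the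
  roots of the cubic, hence a function of \<open>\<beta>\<close> alone.\<close>

lemma cycle_multiplier:
  assumes root: "poly (Q \<beta>) t = 0"
  shows "(\<beta> + 1 + 2 / t) * (\<beta> + 1 + 2 / (- 1 - 1 / t)) * (\<beta> + 1 + 2 / (- 1 / (t + 1)))
    = 1 - 7 * \<beta> - \<beta>\<^sup>2 - \<beta> ^ 3"
proof -
  have t: "t \<noteq> 0" "t + 1 \<noteq> 0" "root_param t = \<beta>" using root by (auto simp: poly_Q_eq_0_iff)
  define i j where "i = 1 / t" and "j = 1 / (t + 1)"
  have "- 1 - 1 / t = - (t + 1) / t" using t by (simp add: field_simps)
  then have "2 / t = 2 * i" "2 / (- 1 - 1 / t) = 2 * (- 1 + j)" "2 / (- 1 / (t + 1)) = - 2 * (t + 1)"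
    using t by (simp_all add: i_def j_def field_simps)
  moreover have "i * t = 1" "j * (t + 1) = 1" "t - i - j = \<beta>"
    using t by (auto simp: i_def j_def root_param_def)
  ultimately show ?thesis by algebra
qed

text \<open>A 3-cycle is recovered from its points by following \<open>g\<close>; this gives the
  uniqueness behind \<open>cycle_delta\<close>.\<close>

lemma three_cycle_eq_orbits:
  "three_cycle g C \<Longrightarrow> C = (\<lambda>x. (x, g x, g (g x))) ` cycle_points C"
  by (auto simp: three_cycle_def cycle_points_def)

lemma cycle_delta_eq:
  assumes a: "a \<noteq> 0" and g: "g = (\<lambda>t. a * t\<^sup>2 + b * t + c)"
    and disc: "\<delta> = b\<^sup>2 - 4 * a * c - 2 * b - 7" "\<delta> \<ge> 0"
  shows "cycle_delta g a b \<delta> =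
    (\<lambda>x. (x, g x, g (g x))) ` cycle_point a b (sqrt \<delta>) ` {t. poly (Q (sqrt \<delta>)) t = 0}"
proof -
  define \<beta> where "\<beta> = sqrt \<delta>"
  define P where "P = cycle_point a b \<beta> ` {t. poly (Q \<beta>) t = 0}"
  have pts: "(\<lambda>i. (- b + \<beta> + 1) / (2 * a) + 1 / (a * q \<beta> i)) ` {1, 2, 3} = P"
    unfolding P_def Q_roots(1) by (simp add: cycle_point_def)
  define t1 t2 t3 where "t1 = q \<beta> 1" and "t2 = q \<beta> 2" and "t3 = q \<beta> 3"
  note roots = Q_roots[of \<beta>, folded t1_def t2_def t3_def]
  have root: "poly (Q \<beta>) t1 = 0" "poly (Q \<beta>) t2 = 0" "poly (Q \<beta>) t3 = 0" using roots(1) by auto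
  have step: "g (cycle_point a b \<beta> t) = cycle_point a b \<beta> (- 1 - 1 / t)" if "poly (Q \<beta>) t = 0" for t
    unfolding g by (rule cycle_point_step[OF a _ that]) (use disc in \<open>simp add: \<beta>_def\<close>)
  \<comment> \<open>The image of each root is again a root, so its position relative to -1 and 0
    identifies it. The roots are visited in the order \<open>t3\<close>, \<open>t1\<close>,
    \<open>t2\<close>.\<close>
  have s3: "- 1 - 1 / t3 = t1"
  proof -
    have "- 1 - 1 / t3 \<in> {t1, t2, t3}" using Q_root_shift[OF root(3)] roots(1) by blast
    moreover have "- 1 - 1 / t3 < - 1" using roots(5) by simp
    ultimately show ?thesis using roots by auto
  qed
  have s1: "- 1 - 1 / t1 = t2"
  proof -
    have "- 1 - 1 / t1 \<in> {t1, t2, t3}" using Q_root_shift[OF root(1)] roots(1) by blast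
    moreover have "- 1 - 1 / t1 > - 1" "- 1 - 1 / t1 < 0"
      using roots(2) by (simp_all add: field_simps)
    ultimately show ?thesis using roots by auto
  qed
  have s2: "- 1 - 1 / t2 = t3"
    using Q_root_shift_twice[OF root(3)] s3 s1 by simp
  define C where "C = (\<lambda>x. (x, g x, g (g x))) ` P"
  have CP: "cycle_points C = P" by (auto simp: C_def cycle_points_def)
  define x y z where "x = cycle_point a b \<beta> t3" and "y = cycle_point a b \<beta> t1"
    and "z = cycle_point a b \<beta> t2"
  have gs: "g x = y" "g y = z" "g z = x"
    by (simp_all only: x_def y_def z_def step root s1 s2 s3)
  have "t3 \<noteq> t1" "t1 \<noteq> t2" "t3 \<noteq> t2" "t1 \<noteq> 0" "t2 \<noteq> 0" "t3 \<noteq> 0" using roots(2-5) by linarith+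
  then have "x \<noteq> y" "y \<noteq> z" "x \<noteq> z"
    unfolding x_def y_def z_def using cycle_point_inj[OF a] by blast+
  moreover have "C = {(x, y, z), (y, z, x), (z, x, y)}"
    unfolding C_def P_def roots(1) by (simp add: gs insert_commute flip: x_def y_def z_def)
  ultimately have cyc: "three_cycle g C"
    unfolding three_cycle_def using gs by blast
  have "cycle_delta g a b \<delta> = C"
    unfolding cycle_delta_def \<beta>_def[symmetric] pts
  proof (rule the_equality)
    show "three_cycle g C \<and> cycle_points C = P" using cyc CP by simp
    show "C' = C" if "three_cycle g C' \<and> cycle_points C' = P" for C'
      using three_cycle_eq_orbits[of g C'] that unfolding C_def by simp
  qed
  then show ?thesis by (simp add: C_def P_def \<beta>_def)
qed

section \<open>From the multiplier to the ratio\<close>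

theorem theorem2p7:
  fixes a b c \<delta> x y z r :: real and g :: "real \<Rightarrow> real"
  assumes "a \<noteq> 0"
    and "g = (\<lambda>t. a * t\<^sup>2 + b * t + c)"
    and "\<delta> = b\<^sup>2 - 4 * a * c - 2 * b - 7"
    and "\<delta> > 0"
    and "(x, y, z) \<in> cycle_delta g a b \<delta>"
    and "r = (z - y) / (y - x)"
  shows "(asymptotically_stable_cycle g (cycle_delta g a b \<delta>) \<longleftrightarrow>
           r \<in> {q 0 1 <.. q \<beta>_crit 1} \<union> {q 0 2 <.. q \<beta>_crit 2} \<union> {q 0 3 <.. q \<beta>_crit 3})
       \<and> decimal_trunc 3 (q 0 1) = - 1.801 \<and> decimal_trunc 3 (q \<beta>_crit 1) = - 1.713
       \<and> decimal_trunc 3 (q 0 2) = - 0.445 \<and> decimal_trunc 3 (q \<beta>_crit 2) = - 0.416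
       \<and> decimal_trunc 3 (q 0 3) = 1.246 \<and> decimal_trunc 3 (q \<beta>_crit 3) = 1.401"
proof -
  define \<beta> where "\<beta> = sqrt \<delta>"
  have \<beta>: "\<beta> > 0" "b\<^sup>2 - 4 * a * c - 2 * b - 7 = \<beta>\<^sup>2" using assms(3,4) by (auto simp: \<beta>_def)
  have C: "cycle_delta g a b \<delta> =
      (\<lambda>x. (x, g x, g (g x))) ` cycle_point a b \<beta> ` {t. poly (Q \<beta>) t = 0}"
    unfolding \<beta>_def using cycle_delta_eq[OF assms(1-3)] assms(4) by simp
  have orbit: "g (cycle_point a b \<beta> t) = cycle_point a b \<beta> (- 1 - 1 / t)"
    "g (cycle_point a b \<beta> (- 1 - 1 / t)) = cycle_point a b \<beta> (- 1 / (t + 1))"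
    "g (cycle_point a b \<beta> (- 1 / (t + 1))) = cycle_point a b \<beta> t"
    if t: "poly (Q \<beta>) t = 0" for t
  proof -
    have step: "g (cycle_point a b \<beta> s) = cycle_point a b \<beta> (- 1 - 1 / s)" if "poly (Q \<beta>) s = 0" for s
      unfolding assms(2) by (rule cycle_point_step[OF assms(1) \<beta>(2) that])
    note t' = Q_root_shift[OF t]
    note t'' = Q_root_shift[OF t', unfolded Q_root_shift_twice(1)[OF t]]
    show "g (cycle_point a b \<beta> t) = cycle_point a b \<beta> (- 1 - 1 / t)"
      "g (cycle_point a b \<beta> (- 1 - 1 / t)) = cycle_point a b \<beta> (- 1 / (t + 1))"
      "g (cycle_point a b \<beta> (- 1 / (t + 1))) = cycle_point a b \<beta> t"
      using step[OF t] step[OF t'] step[OF t''] Q_root_shift_twice[OF t] by simp_all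
  qed
  \<comment> \<open>Positivity of \<open>\<beta>\<close> keeps the multiplier strictly below 1, as
    the stability criterion requires.\<close>
  have pos: "7 * \<beta> + \<beta>\<^sup>2 + \<beta> ^ 3 > 0" using \<beta>(1) by (simp add: add_pos_pos)
  have stable: "lyapunov_stable3 g (cycle_point a b \<beta> t) \<and> attracting3 g (cycle_point a b \<beta> t)
      \<longleftrightarrow> \<beta> \<le> \<beta>_crit" if t: "poly (Q \<beta>) t = 0" for t
  proof -
    have "lyapunov_stable3 g (cycle_point a b \<beta> t) \<and> attracting3 g (cycle_point a b \<beta> t)
      \<longleftrightarrow> - 1 \<le> 1 - 7 * \<beta> - \<beta>\<^sup>2 - \<beta> ^ 3"
    proof (rule quadratic_three_cycle_asymptotically_stable_iff[OF assms(1,2) orbit[OF t]])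
      show "1 - 7 * \<beta> - \<beta>\<^sup>2 - \<beta> ^ 3 < 1" using pos by linarith
    qed (simp only: cycle_point_slope[OF assms(1)] cycle_multiplier[OF t])
    also have "\<dots> \<longleftrightarrow> \<beta> \<le> \<beta>_crit" unfolding le_\<beta>_crit_iff by linarith
    finally show ?thesis .
  qed
  have points: "cycle_points (cycle_delta g a b \<delta>) = cycle_point a b \<beta> ` {t. poly (Q \<beta>) t = 0}"
    unfolding C cycle_points_def by auto
  obtain t where t: "poly (Q \<beta>) t = 0" "x = cycle_point a b \<beta> t" "y = g x" "z = g (g x)"
    using assms(5) unfolding C by auto
  have "r = t"
    using cycle_point_ratio[OF assms(1) t(1), of b] by (simp only: assms(6) t(2-4) orbit[OF t(1)])
  \<comment> \<open>The criterion is the same at all points of the cycle, so the existential over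
    its points disappears.\<close>
  have "asymptotically_stable_cycle g (cycle_delta g a b \<delta>) \<longleftrightarrow> \<beta> \<le> \<beta>_crit"
    unfolding asymptotically_stable_cycle_def points using stable t(1) by auto
  also have "\<dots> \<longleftrightarrow>
      r \<in> {q 0 1 <.. q \<beta>_crit 1} \<union> {q 0 2 <.. q \<beta>_crit 2} \<union> {q 0 3 <.. q \<beta>_crit 3}"
    \<comment> \<open>The lower parameter is 0, and \<open>\<beta> > 0\<close> makes the left ends
      open.\<close>
    unfolding \<open>r = t\<close> by (rule root_in_ranges_iff[OF t(1) \<beta>(1), symmetric])
  finally show ?thesis using decimal_expansions by blast
qed

end
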